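(* Let $r \ge 1$ be an integer and let \[ F(x,y) = f_{0}(x) + f_{1}(x) y + \cdots + f_{r}(x) y^{r} \in \mathbb Z[x,y], \] where $f_0,\dots,f_r\in\mathbb Z[x]$ satisfy: the only common divisors of $f_{0}(x), f_{1}(x), \ldots, f_{r}(x)$ in $\mathbb Z[x]$ are $\pm 1$, $f_{0}(0) \ne 0$, and $f_{r}(x) \ne 0$. Then for every sufficiently large positive integer $n$ (i.e. for all $n\ge N$, where $N$ depends only on $f_0,\dots,f_r$) the following holds: the non-reciprocal part of $F(x,x^{n})$ is not reducible (that is, it is either $1$ or irreducible) provided that both of the following conditions hold: <ul> <li>whenever $n = k \ell + t$ with integers $k,\ell,t$ satisfying $k \ge 2 \max_{0 \le j \le r} \{ \deg f_{j} \}$ and $0 \le t < \frac{k}{r(r+1)}$, the polynomial \[ f_{0}(x) + f_{1}(x) x^{t} y^{\ell} + \cdots + f_{r-1}(x) x^{(r-1)t} y^{(r-1)\ell} + f_{r}(x) x^{rt} y^{r \ell} \] is a power of $x$ (possibly $x^{0}$) times an irreducible polynomial in $\mathbb Z[x,y]$;</li> <li>whenever $n = k \ell - t$ with integers $k,\ell,t$ satisfying $k \ge 2 \max_{0 \le j \le r} \{ \deg f_{j} \}$ and $0 \le t < \frac{k}{r(r+1)}$, the polynomial \[ f_{0}(x) x^{rt} + f_{1}(x) x^{(r-1)t} y^{\ell} + \cdots + f_{r-1}(x) x^{t} y^{(r-1)\ell} + f_{r}(x) y^{r \ell} \] is a power of $x$ (possibly $x^{0}$) times an irreducible polynomial in $\mathbb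 Z[x,y]$.</li> </ul>
   Context: For a nonzero $f(x)\in\mathbb Q[x]$, its reciprocal is $\tilde f(x)=x^{\deg f}f(1/x)$, and $f$ is called reciprocal if $f(x)=\pm\tilde f(x)$. The non-reciprocal part of a nonzero $f(x)\in\mathbb Z[x]$ is the polynomial obtained from $f(x)$ by removing every irreducible reciprocal factor in $\mathbb Z[x]$ having positive leading coefficient, each to the full multiplicity with which it divides $f(x)$, so that only irreducible non-reciprocal factors remain. "Not reducible" is used to allow the non-reciprocal part to be $1$.
   Formalization: The conclusion also allows the non-reciprocal part to be -1: only factors with positive leading coefficient are removed, so a sign can survive (for example f_0 = f_1 = -1, r = 1, n a power of 2 gives -1), and "either 1 or irreducible" fails as literally stated. *)

theory Defs
  imports
    Complex_Main
    "HOL-Computational_Algebra.Computational_Algebra"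
begin

text \<open>
  For \<open>p \<noteq> 0\<close>, \<^const>\<open>reflect_poly\<close> \<open>p\<close> is \<open>x^(degree p) * p (1/x)\<close>.
  In particular the polynomial \<open>x\<close> is not reciprocal, while every nonzero constant is;
  so over the integers the (positive) primes are among the irreducible reciprocal polynomials.
\<close>

definition reciprocal :: "'a::comm_ring_1 poly \<Rightarrow> bool" where
  "reciprocal p \<longleftrightarrow> p = reflect_poly p \<or> p = - reflect_poly p"

text \<open>
  Requiring a positive leading coefficient selects one representative of each pair \<open>\<plusminus> p\<close> of
  associated irreducibles. The division is exact, and a sign of \<open>p\<close> is not removed, so
  if \<open>p \<noteq> 0\<close> has no non-reciprocal irreducible factor the result is \<open>1\<close> or \<open>-1\<close>.
\<close>

definition nonreciprocal_part :: "int poly \<Rightarrow> int poly" where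
  "nonreciprocal_part p =
     p div (\<Prod>q | irreducible q \<and> reciprocal q \<and> lead_coeff q > 0 \<and> q dvd p. q ^ multiplicity q p)"

text \<open>
  Elements of \<open>\<int>[x,y]\<close> are represented in \<^typ>\<open>int poly poly\<close>: the outer variable is \<open>y\<close>, and the
  coefficients are polynomials in \<open>x\<close>. Hence \<open>F(x, x^n)\<close> is the value \<open>poly F (monom 1 n)\<close>.
\<close>

definition bivar :: "nat \<Rightarrow> (nat \<Rightarrow> int poly) \<Rightarrow> int poly poly" where
  "bivar r f = (\<Sum>j\<le>r. monom (f j) j)"

definition bivar_plus :: "nat \<Rightarrow> (nat \<Rightarrow> int poly) \<Rightarrow> nat \<Rightarrow> nat \<Rightarrow> int poly poly" where
  "bivar_plus r f t l = (\<Sum>j\<le>r. monom (f j * monom 1 (j * t)) (j * l))"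

definition bivar_minus :: "nat \<Rightarrow> (nat \<Rightarrow> int poly) \<Rightarrow> nat \<Rightarrow> nat \<Rightarrow> int poly poly" where
  "bivar_minus r f t l = (\<Sum>j\<le>r. monom (f j * monom 1 ((r - j) * t)) (j * l))"

definition x_power_times_irreducible :: "int poly poly \<Rightarrow> bool" where
  "x_power_times_irreducible G \<longleftrightarrow> (\<exists>a P. irreducible P \<and> G = [:monom 1 a:] * P)"

text \<open>
  The conditions on \<open>k\<close> and \<open>t\<close> force \<open>k > t \<ge> 0\<close>; with \<open>n > 0\<close> this gives \<open>l \<ge> 0\<close> in \<open>n = k l + t\<close>
  and \<open>l \<ge> 1\<close> in \<open>n = k l - t\<close> for integers \<open>k, l, t\<close>, so natural numbers suffice.
  The value \<open>l = 0\<close> is excluded in the first condition as well: otherwise, taking \<open>t = n\<close> and \<open>k\<close>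
  large, the condition would contain the irreducibility of \<open>F(x, x^n)\<close> up to a power of \<open>x\<close>.
\<close>

definition plus_condition :: "nat \<Rightarrow> (nat \<Rightarrow> int poly) \<Rightarrow> nat \<Rightarrow> bool" where
  "plus_condition r f n \<longleftrightarrow>
     (\<forall>k l t. l \<ge> 1 \<and> n = k * l + t \<and> k \<ge> 2 * Max ((\<lambda>j. degree (f j)) ` {0..r}) \<and>
        real t < real k / real (r * (r + 1))
      \<longrightarrow> x_power_times_irreducible (bivar_plus r f t l))"

definition minus_condition :: "nat \<Rightarrow> (nat \<Rightarrow> int poly) \<Rightarrow> nat \<Rightarrow> bool" where
  "minus_condition r f n \<longleftrightarrow>
     (\<forall>k l t. l \<ge> 1 \<and> int n = int k * int l - int t \<and>
        k \<ge> 2 * Max ((\<lambda>j. degree (f j)) ` {0..r}) \<and>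
        real t < real k / real (r * (r + 1))
      \<longrightarrow> x_power_times_irreducible (bivar_minus r f t l))"

end

(* Write F for F(x, x^n) and w~ for the reversal of w. If the non-reciprocal part of F is reducible,
   then F = a b R with R reciprocal and a, b not, so w = a b~ R satisfies w w~ = F F~ although w is
   none of +-F, +-F~. Comparing middle coefficients, w has the same Euclidean norm as F, hence a
   number of terms bounded independently of n. By Dirichlet's simultaneous approximation theorem
   some m bounded independently of n makes every e m / n, for e an exponent of w, close to an
   integer. With k = n div m and t = n mod m all exponents of w and F are then close to multiples of
   k, so that after multiplication by a power of x the identity w w~ = F F~ lifts along y = x^k to
   an identity in Z[x,y]. There F becomes the polynomial of the first condition (with l = m), which
   is irreducible and so divides the lift of w or of w~. Setting y = x^k again, F divides w or w~,
   which forces w to be one of +-F, +-F~. *)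
theory Submission
  imports Defs "HOL-Analysis.Kronecker_Approximation_Theorem"
begin

section \<open>Units, irreducibles and reversal in Z[x]\<close>

lemma is_unit_int_poly_iff: "is_unit p \<longleftrightarrow> p = 1 \<or> p = - 1" for p :: "int poly"
proof
  assume "is_unit p"
  then obtain c where "p = [:c:]" "is_unit c"
    by (auto simp: is_unit_poly_iff)
  then show "p = 1 \<or> p = - 1"
    by (auto simp: one_pCons)
next
  assume "p = 1 \<or> p = - 1"
  then show "is_unit p" by auto
qed

lemma irreducible_dvd_irreducible_int_poly:
  fixes p q :: "int poly"
  assumes "irreducible p" "irreducible q" "p dvd q"
  shows "q = p \<or> q = - p"
proof -
  obtain u where u: "q = p * u" using assms(3) by blast
  then have "is_unit u"
    using assms irreducibleD irreducible_not_unit by blast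
  then show ?thesis using u by (auto simp: is_unit_int_poly_iff)
qed

lemma irreducible_uminus: "irreducible (- p)" if "irreducible p" for p :: "'a::{idom_divide,algebraic_semidom}"
proof (rule irreducibleI)
  fix a b assume "- p = a * b"
  then have "p = (- a) * b" by (metis minus_minus minus_mult_left)
  then show "is_unit a \<or> is_unit b"
    using that irreducibleD[of p "- a" b] by simp
qed (use that in \<open>auto simp: irreducible_not_unit\<close>)

lemma reflect_poly_minus: "reflect_poly (- p) = - reflect_poly p" for p :: "'a::idom poly"
  using reflect_poly_smult[of "-1" p] by simp

lemma reciprocal_uminus_iff [simp]: "reciprocal (- p) \<longleftrightarrow> reciprocal p" for p :: "'a::idom poly"
  by (metis add.inverse_inverse reciprocal_def reflect_poly_minus)

lemma reciprocal_mult: "reciprocal p \<Longrightarrow> reciprocal q \<Longrightarrow> reciprocal (p * q)" for p q :: "'a::idom poly"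
  unfolding reciprocal_def reflect_poly_mult by (metis minus_mult_left minus_mult_right minus_minus)

lemma reciprocal_1 [simp]: "reciprocal (1 :: 'a::idom poly)"
  by (simp add: reciprocal_def)

lemma reciprocal_power: "reciprocal p \<Longrightarrow> reciprocal (p ^ n)" for p :: "'a::idom poly"
  by (induction n) (auto intro: reciprocal_mult)

lemma reciprocal_prod: "(\<And>i. i \<in> I \<Longrightarrow> reciprocal (p i)) \<Longrightarrow> reciprocal (prod p I)"
  for p :: "'i \<Rightarrow> 'a::idom poly"
  by (induction I rule: infinite_finite_induct) (auto intro: reciprocal_mult)

lemma reflect_poly_dvd: "p dvd q \<Longrightarrow> reflect_poly p dvd reflect_poly q" for p q :: "'a::idom poly"
  by (auto simp: reflect_poly_mult dvd_def)

text \<open>A nonzero constant term makes reversal an involution on \<open>p\<close>, and it passes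
  to the factors of the reversal, so factorizations and units can be carried back and forth.\<close>

lemma irreducible_reflect_poly:
  fixes p :: "'a::idom_divide poly"
  assumes p: "irreducible p" and p0: "coeff p 0 \<noteq> 0"
  shows "irreducible (reflect_poly p)"
proof (rule irreducibleI)
  show "reflect_poly p \<noteq> 0" using p by auto
  show "\<not> is_unit (reflect_poly p)"
    using reflect_poly_dvd[of "reflect_poly p" 1] p p0 by (auto simp: irreducible_not_unit)
  fix a b assume ab: "reflect_poly p = a * b"
  have "coeff (a * b) 0 \<noteq> 0" using p ab[symmetric] by auto
  then have ab0: "coeff a 0 \<noteq> 0" "coeff b 0 \<noteq> 0" by (auto simp: coeff_mult_0)
  have "p = reflect_poly a * reflect_poly b"
    using ab p0 by (metis reflect_poly_mult reflect_poly_reflect_poly)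
  then have "is_unit (reflect_poly a) \<or> is_unit (reflect_poly b)"
    using p irreducibleD by blast
  then show "is_unit a \<or> is_unit b"
    using reflect_poly_dvd[of "reflect_poly a" 1] reflect_poly_dvd[of "reflect_poly b" 1] ab0 by auto
qed

lemma irreducible_dvd_mult_int_poly:
  "irreducible p \<Longrightarrow> p dvd a * b \<Longrightarrow> p dvd a \<or> p dvd b" for p a b :: "int poly"
  using prime_elem_dvd_mult_iff prime_elem_iff_irreducible by blast

section \<open>The non-reciprocal part and companions of F\<close>

text \<open>The removed product divides \<open>F\<close> because it is part of the prime
  factorization. A reciprocal irreducible left in the quotient would divide \<open>F\<close> once
  more often than its multiplicity allows.\<close>

lemma nonreciprocal_part_props:
  fixes F :: "int poly"
  assumes F: "F \<noteq> 0"
  obtains R where "F = nonreciprocal_part F * R" "reciprocal R"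
    "\<And>q. irreducible q \<Longrightarrow> reciprocal q \<Longrightarrow> \<not> q dvd nonreciprocal_part F"
proof
  define S where "S = {q. irreducible q \<and> reciprocal q \<and> lead_coeff q > 0 \<and> q dvd F}"
  define R where "R = (\<Prod>q\<in>S. q ^ multiplicity q F)"
  have normalize_eq: "normalize q = q" if "lead_coeff q > 0" for q :: "int poly"
    using that by (simp add: normalize_poly_def unit_factor_poly_def flip: one_pCons)
  have S_sub: "S \<subseteq> prime_factors F"
    using F by (auto simp: S_def in_prime_factors_iff prime_def prime_elem_iff_irreducible normalize_eq)
  then have fin: "finite S" using finite_subset by blast
  have "R dvd (\<Prod>q\<in>prime_factors F. q ^ multiplicity q F)"
    unfolding R_def by (intro prod_dvd_prod_subset S_sub) auto
  also have "\<dots> = prod_mset (prime_factorization F)"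
    using F by (auto simp: prod_mset_multiplicity count_prime_factorization_prime
        in_prime_factors_imp_prime intro!: prod.cong)
  also have "\<dots> dvd F"
    using prod_mset_prime_factorization_weak[OF F] by (metis dvd_normalize_iff dvd_refl normalize_dvd_iff)
  finally have R_dvd: "R dvd F" .
  have P_eq: "nonreciprocal_part F = F div R"
    by (simp add: nonreciprocal_part_def R_def S_def)
  show split: "F = nonreciprocal_part F * R" using R_dvd P_eq by simp
  show "reciprocal R"
    unfolding R_def by (intro reciprocal_prod reciprocal_power) (auto simp: S_def)
  have pos: False if q: "irreducible q" "reciprocal q" "q dvd nonreciprocal_part F" "lead_coeff q > 0" for q
  proof -
    have "q \<in> S" using q split by (metis (mono_tags) S_def dvd_mult2 mem_Collect_eq)
    then have "q ^ multiplicity q F dvd R" unfolding R_def by (intro dvd_prodI fin)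
    then have "q ^ Suc (multiplicity q F) dvd F"
      using mult_dvd_mono[OF q(3)] split by (metis power_Suc)
    then show False
      using F q(1) power_dvd_iff_le_multiplicity[of F q] irreducible_not_unit Suc_n_not_le_n by metis
  qed
  fix q :: "int poly" assume q: "irreducible q" "reciprocal q"
  show "\<not> q dvd nonreciprocal_part F"
  proof
    assume "q dvd nonreciprocal_part F"
    \<comment> \<open>Only irreducibles with positive leading coefficient are removed, so the claim
      for \<open>q\<close> is reduced to \<open>q\<close> or \<open>- q\<close>.\<close>
    moreover have "lead_coeff q > 0 \<or> lead_coeff (- q) > 0"
      using q(1) by (metis coeff_minus degree_minus leading_coeff_0_iff linorder_neqE_linordered_idom
          neg_0_less_iff_less not_irreducible_zero)
    ultimately show False using pos[of q] pos[of "- q"] q by (auto intro: irreducible_uminus)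
  qed
qed

text \<open>The naive choice of \<open>a\<close> as an irreducible factor fails when the cofactor \<open>h\<close> is reciprocal.
  Then \<open>h\<close> contains a pair \<open>p\<close>, \<open>reflect_poly p\<close>, and moving one of the two to \<open>a\<close> works.\<close>

lemma nonreciprocal_split:
  fixes P :: "int poly"
  assumes P0: "coeff P 0 \<noteq> 0" and "\<not> is_unit P" and P_red: "\<not> irreducible P"
    and nonrec: "\<And>q. irreducible q \<Longrightarrow> reciprocal q \<Longrightarrow> \<not> q dvd P"
  obtains a b where "P = a * b" "\<not> reciprocal a" "\<not> reciprocal b"
proof -
  obtain g where g: "irreducible g" "g dvd P"
    using prime_divisor_exists[of P] assms by (metis coeff_0 prime_elem_iff_irreducible prime_imp_prime_elem)
  obtain h where h: "P = g * h" using g(2) by blast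
  have g_nr: "\<not> reciprocal g" using g nonrec by blast
  show ?thesis
  proof (cases "reciprocal h")
    case False
    then show ?thesis using that h g_nr by blast
  next
    case True
    have gh0: "coeff g 0 \<noteq> 0" "coeff h 0 \<noteq> 0" using P0 h by (auto simp: coeff_mult_0)
    have "\<not> is_unit h"
      using P_red g(1) h by (auto simp: is_unit_int_poly_iff irreducible_uminus)
    then obtain p where p: "irreducible p" "p dvd h"
      using prime_divisor_exists[of h] gh0 by (metis coeff_0 prime_elem_iff_irreducible prime_imp_prime_elem)
    obtain h1 where h1: "h = p * h1" using p(2) by blast
    have p0: "coeff p 0 \<noteq> 0" using gh0 h1 by (auto simp: coeff_mult_0)
    have p_nr: "\<not> reciprocal p" using p nonrec h by (meson dvd_trans dvd_triv_right)
    define p' where "p' = reflect_poly p"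
    define g' where "g' = reflect_poly g"
    have p': "irreducible p'" "reflect_poly p' = p"
      using irreducible_reflect_poly[OF p(1) p0] p0 by (auto simp: p'_def)
    have g': "irreducible g'" "reflect_poly g' = g"
      using irreducible_reflect_poly[OF g(1) gh0(1)] gh0 by (auto simp: g'_def)
    have pp: "p' \<noteq> p" "p' \<noteq> - p" "p \<noteq> p'" "p \<noteq> - p'" using p_nr by (auto simp: reciprocal_def p'_def)
    have gg: "g' \<noteq> g" "g' \<noteq> - g" "g \<noteq> g'" "g \<noteq> - g'" using g_nr by (auto simp: reciprocal_def g'_def)
    \<comment> \<open>As \<open>h\<close> is reciprocal, the reversal of \<open>p\<close> divides it
      too. It is not associated to \<open>p\<close>, so both can be split off, and cancelling the
      reciprocal product \<open>p * p'\<close> leaves a reciprocal \<open>h2\<close>.\<close>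
    have "p' dvd reflect_poly h" using reflect_poly_dvd p(2) p'_def by blast
    then have "p' dvd p * h1"
      using True h1 by (metis dvd_minus_iff reciprocal_def)
    moreover have "\<not> p' dvd p" using irreducible_dvd_irreducible_int_poly[OF p'(1) p(1)] pp by auto
    ultimately have "p' dvd h1" using irreducible_dvd_mult_int_poly p'(1) by blast
    then obtain h2 where h2: "h1 = p' * h2" by blast
    have h_eq: "h = p * (p' * h2)" using h1 h2 by simp
    have h2_nz: "h2 \<noteq> 0" using gh0 h_eq by auto
    have "p * p' * h2 = p * p' * reflect_poly h2 \<or> p * p' * h2 = p * p' * (- reflect_poly h2)"
      using True unfolding h_eq reciprocal_def reflect_poly_mult p'(2) p'_def[symmetric]
      by (simp add: mult_ac)
    then have h2_rec: "h2 = reflect_poly h2 \<or> h2 = - reflect_poly h2"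
      using p(1) p'(1) by (metis mult_cancel_left mult_eq_0_iff not_irreducible_zero)
    have b1: "\<not> reciprocal (p' * h2)"
    proof
      assume "reciprocal (p' * h2)"
      then have "p' * h2 = p * h2 \<or> p' * h2 = (- p) * h2"
        using h2_rec unfolding reciprocal_def reflect_poly_mult p'(2)
        by (metis minus_mult_left minus_mult_right minus_minus)
      then show False using h2_nz pp by (metis mult_cancel_right)
    qed
    have b2: "\<not> reciprocal (p * h2)"
    proof
      assume "reciprocal (p * h2)"
      then have "p * h2 = p' * h2 \<or> p * h2 = (- p') * h2"
        using h2_rec unfolding reciprocal_def reflect_poly_mult p'_def
        by (metis minus_mult_left minus_mult_right minus_minus)
      then show False using h2_nz pp by (metis mult_cancel_right)
    qed
    have g_g': "\<not> g dvd g'" using irreducible_dvd_irreducible_int_poly[OF g(1) g'(1)] gg by auto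
    have a1: "p' = g \<or> p' = - g" if "reciprocal (g * p)"
    proof -
      have "g dvd g' * p'" using that unfolding reciprocal_def reflect_poly_mult p'_def g'_def
        by (metis dvd_minus_iff dvd_triv_left)
      then show ?thesis
        using g_g' irreducible_dvd_mult_int_poly g(1) irreducible_dvd_irreducible_int_poly p'(1) by blast
    qed
    have a2: "p = g \<or> p = - g" if "reciprocal (g * p')"
    proof -
      have "g dvd g' * p" using that unfolding reciprocal_def reflect_poly_mult p'(2) g'_def
        by (metis dvd_minus_iff dvd_triv_left)
      then show ?thesis
        using g_g' irreducible_dvd_mult_int_poly g(1) irreducible_dvd_irreducible_int_poly p(1) by blast
    qed
    \<comment> \<open>If both products were reciprocal, \<open>p\<close> and \<open>p'\<close> would
      both be associated to \<open>g\<close>, hence to each other, making \<open>p\<close>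
      reciprocal.\<close>
    have "\<not> reciprocal (g * p) \<or> \<not> reciprocal (g * p')" using a1 a2 pp by fastforce
    then show ?thesis
      using that[of "g * p" "p' * h2"] that[of "g * p'" "p * h2"] b1 b2 h h_eq by (auto simp: mult_ac)
  qed
qed

text \<open>Reversing only the factor \<open>b\<close> keeps the product with the reversal. After
  cancellation, \<open>w\<close> equal to \<open>F\<close> up to sign would make \<open>b\<close>
  reciprocal, and \<open>w\<close> equal to the reversal of \<open>F\<close> up to sign would make
  \<open>a\<close> reciprocal.\<close>

lemma nonreciprocal_part_reducible_companion:
  fixes F :: "int poly"
  assumes F0: "coeff F 0 \<noteq> 0"
    and red: "nonreciprocal_part F \<noteq> 1" "nonreciprocal_part F \<noteq> - 1"
      "\<not> irreducible (nonreciprocal_part F)"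
  obtains w where "w * reflect_poly w = F * reflect_poly F"
    "w \<noteq> F" "w \<noteq> - F" "w \<noteq> reflect_poly F" "w \<noteq> - reflect_poly F"
proof -
  have F_nz: "F \<noteq> 0" using F0 by auto
  from nonreciprocal_part_props[OF F_nz] obtain R where
    R: "F = nonreciprocal_part F * R" "reciprocal R"
      "\<And>q. irreducible q \<Longrightarrow> reciprocal q \<Longrightarrow> \<not> q dvd nonreciprocal_part F" by metis
  define P where "P = nonreciprocal_part F"
  have PR: "F = P * R" using R(1) P_def by simp
  have PR0: "coeff P 0 \<noteq> 0" "R \<noteq> 0" using F0 PR by (auto simp: coeff_mult_0)
  obtain a b where ab: "P = a * b" "\<not> reciprocal a" "\<not> reciprocal b"
    using nonreciprocal_split[of P] PR0 R(3) red is_unit_int_poly_iff P_def by blast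
  have ab0: "coeff a 0 \<noteq> 0" "coeff b 0 \<noteq> 0" "a \<noteq> 0" "b \<noteq> 0" using PR0 ab by (auto simp: coeff_mult_0)
  define w where "w = a * reflect_poly b * R"
  have R_cases: "reflect_poly R = R \<or> reflect_poly R = - R"
    using R(2) by (auto simp: reciprocal_def)
  show ?thesis
  proof (rule that[of w])
    show "w * reflect_poly w = F * reflect_poly F"
      using ab0 by (simp add: w_def PR ab reflect_poly_mult mult_ac)
    have 1: "b = c * reflect_poly b" if "a * R * b = a * R * (c * reflect_poly b)" for c
      using that ab0 PR0 by simp
    have 2: "a = c * reflect_poly a" if "reflect_poly b * R * a = reflect_poly b * R * (c * reflect_poly a)" for c
      using that ab0 PR0 by simp
    show "w \<noteq> F" "w \<noteq> - F"
      using 1[of 1] 1[of "- 1"] ab(3)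
      by (auto simp: w_def PR ab reciprocal_def mult_ac)
    have "R * a \<noteq> - (R * reflect_poly a)"
      using ab(2) PR0(2) by (metis mult_cancel_left mult_minus_right reciprocal_def)
    then show "w \<noteq> reflect_poly F" "w \<noteq> - reflect_poly F"
      using 2[of 1] 2[of "- 1"] ab(2) R_cases
      by (auto simp: w_def PR ab reflect_poly_mult reciprocal_def mult_ac)
  qed
qed

section \<open>Lifting from Z[x] to Z[x,y] along y = x^k\<close>

text \<open>Division of each exponent by \<open>k\<close> gives a right inverse of the substitution
  y = x^k that keeps x-degrees below \<open>k\<close> when \<open>k > 0\<close>.\<close>

definition lift_poly :: "nat \<Rightarrow> int poly \<Rightarrow> int poly poly" where
  "lift_poly k p = (\<Sum>i\<le>degree p. monom (monom (coeff p i) (i mod k)) (i div k))"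

lemma poly_lift_poly: "poly (lift_poly k p) (monom 1 k) = p"
proof -
  have "poly (lift_poly k p) (monom 1 k) = (\<Sum>i\<le>degree p. monom (coeff p i) i)"
    by (simp add: lift_poly_def poly_sum poly_monom monom_power mult_monom add.commute)
  then show ?thesis by (simp add: poly_as_sum_of_monoms)
qed

lemma degree_coeff_lift_poly_le:
  assumes "\<And>i. coeff p i \<noteq> 0 \<Longrightarrow> i mod k \<le> B"
  shows "degree (coeff (lift_poly k p) j) \<le> B"
proof -
  have "degree (if i div k = j then monom (coeff p i) (i mod k) else 0) \<le> B" for i
    using assms[of i] order_trans[OF degree_monom_le, of "i mod k" B] by (cases "coeff p i = 0") auto
  then show ?thesis
    by (auto simp: lift_poly_def coeff_sum intro!: degree_sum_le)
qed

text \<open>With all x-degrees below \<open>k\<close>, the coefficient of y^j occupies only the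
  exponents from \<open>k * j\<close> to \<open>k * j + k - 1\<close>. These blocks are disjoint, so
  nothing is mixed; hence the substitution is injective on such polynomials.\<close>

lemma coeff_poly_monom:
  fixes A :: "'a::comm_ring_1 poly poly"
  assumes deg: "\<And>j. degree (coeff A j) < k" and "s < k"
  shows "coeff (poly A (monom 1 k)) (k * j + s) = coeff (coeff A j) s"
proof -
  have term_coeff: "coeff (coeff A i * monom 1 (k * i)) (k * j + s) = (if i = j then coeff (coeff A j) s else 0)" for i
  proof -
    consider "i = j" | "i < j" | "i > j" by linarith
    then show ?thesis
    proof cases
      case 2
      then have "k * Suc i \<le> k * j" by (intro mult_le_mono2) simp
      then have "degree (coeff A i) < k * j + s - k * i" using deg[of i] by simp
      then show ?thesis
        using 2 by (simp add: mult.commute[of _ "monom _ _"] coeff_monom_mult coeff_eq_0)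
    next
      case 3
      then have "k * Suc j \<le> k * i" by (intro mult_le_mono2) simp
      then have "k * j + s < k * i" using \<open>s < k\<close> by simp
      then show ?thesis
        using 3 by (simp add: mult.commute[of _ "monom _ _"] coeff_monom_mult)
    qed (simp add: mult.commute[of _ "monom _ _"] coeff_monom_mult)
  qed
  have "coeff (poly A (monom 1 k)) (k * j + s) = (\<Sum>i\<le>degree A. if i = j then coeff (coeff A j) s else 0)"
    by (simp add: poly_altdef monom_power coeff_sum term_coeff)
  also have "\<dots> = coeff (coeff A j) s"
    by (auto simp: coeff_eq_0 not_le)
  finally show ?thesis .
qed

lemma poly_monom_inject:
  fixes A B :: "'a::comm_ring_1 poly poly"
  assumes "\<And>j. degree (coeff A j) < k" "\<And>j. degree (coeff B j) < k"
    and "poly A (monom 1 k) = poly B (monom 1 k)"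
  shows "A = B"
proof (intro poly_eqI)
  fix j s
  show "coeff (coeff A j) s = coeff (coeff B j) s"
  proof (cases "s < k")
    case True
    then show ?thesis using assms coeff_poly_monom by metis
  next
    case False
    then show ?thesis using assms(1,2)[of j] by (simp add: coeff_eq_0)
  qed
qed

lemma degree_coeff_mult_le:
  assumes "\<And>j. degree (coeff A j) \<le> a" "\<And>j. degree (coeff B j) \<le> b"
  shows "degree (coeff (A * B) j) \<le> a + b"
  unfolding coeff_mult
  by (intro degree_sum_le order_trans[OF degree_mult_le] add_mono assms) auto

section \<open>Euclidean norm and number of terms\<close>

lemma coeff_mult_reflect_poly_degree:
  fixes w :: "'a::comm_ring_1 poly"
  shows "coeff (w * reflect_poly w) (degree w) = (\<Sum>i\<le>degree w. (coeff w i)\<^sup>2)"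
  unfolding coeff_mult by (intro sum.cong) (auto simp: coeff_reflect_poly power2_eq_square)

lemma sum_coeff_shift_le:
  fixes p :: "int poly"
  shows "(\<Sum>i\<le>D. \<bar>coeff (monom 1 c * p) i\<bar>) \<le> (\<Sum>i\<le>degree p. \<bar>coeff p i\<bar>)"
proof -
  have "(\<Sum>i\<le>D. \<bar>coeff (monom 1 c * p) i\<bar>) = (\<Sum>i\<in>{i. i \<le> D \<and> c \<le> i \<and> i - c \<le> degree p}. \<bar>coeff p (i - c)\<bar>)"
    by (intro sum.mono_neutral_cong_right) (auto simp: coeff_monom_mult not_le intro: le_degree)
  also have "\<dots> = (\<Sum>i\<in>(\<lambda>i. i - c) ` {i. i \<le> D \<and> c \<le> i \<and> i - c \<le> degree p}. \<bar>coeff p i\<bar>)"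
    by (subst sum.reindex) (auto simp: inj_on_def)
  also have "\<dots> \<le> (\<Sum>i\<le>degree p. \<bar>coeff p i\<bar>)"
    by (intro sum_mono2) auto
  finally show ?thesis .
qed

lemma sum_squares_le_square_sum:
  fixes g :: "'i \<Rightarrow> int"
  assumes "finite I"
  shows "(\<Sum>i\<in>I. (g i)\<^sup>2) \<le> (\<Sum>i\<in>I. \<bar>g i\<bar>)\<^sup>2"
  using assms
proof (induction I)
  case (insert x I)
  have "0 \<le> (\<Sum>i\<in>I. \<bar>g i\<bar>)" by (intro sum_nonneg) auto
  then have "0 \<le> 2 * \<bar>g x\<bar> * (\<Sum>i\<in>I. \<bar>g i\<bar>)" by (intro mult_nonneg_nonneg) auto
  moreover have "(\<bar>g x\<bar> + (\<Sum>i\<in>I. \<bar>g i\<bar>))\<^sup>2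
      = (g x)\<^sup>2 + (\<Sum>i\<in>I. \<bar>g i\<bar>)\<^sup>2 + 2 * \<bar>g x\<bar> * (\<Sum>i\<in>I. \<bar>g i\<bar>)"
    by (simp add: power2_sum)
  ultimately show ?case
    unfolding sum.insert[OF insert(1,2)] using insert.IH by linarith
qed simp

text \<open>Every nonzero integer has square at least 1, so the squared norm bounds the number of
  terms, and the middle coefficient shows that \<open>w\<close> and \<open>F\<close> share this
  norm. The sum of absolute values serves as the final bound because it is subadditive, even when
  the shifted \<open>f j\<close> overlap.\<close>

lemma card_support_companion_le:
  fixes F w :: "int poly"
  assumes "w * reflect_poly w = F * reflect_poly F" "degree w = degree F"
  shows "int (card {i. coeff w i \<noteq> 0}) \<le> (\<Sum>i\<le>degree F. \<bar>coeff F i\<bar>)\<^sup>2"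
proof -
  have sub: "{i. coeff w i \<noteq> 0} \<subseteq> {..degree w}" by (auto intro: le_degree)
  have "int (card {i. coeff w i \<noteq> 0}) = (\<Sum>i | coeff w i \<noteq> 0. 1)" by simp
  also have "\<dots> \<le> (\<Sum>i | coeff w i \<noteq> 0. (coeff w i)\<^sup>2)"
    by (intro sum_mono) (auto simp: int_one_le_iff_zero_less)
  also have "\<dots> \<le> (\<Sum>i\<le>degree w. (coeff w i)\<^sup>2)"
    using sub by (intro sum_mono2) auto
  also have "\<dots> = (\<Sum>i\<le>degree F. (coeff F i)\<^sup>2)"
    using coeff_mult_reflect_poly_degree[of w] coeff_mult_reflect_poly_degree[of F] assms by simp
  also have "\<dots> \<le> (\<Sum>i\<le>degree F. \<bar>coeff F i\<bar>)\<^sup>2"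
    by (rule sum_squares_le_square_sum) simp
  finally show ?thesis .
qed

section \<open>Lifting the companion identity\<close>

lemma degree_companion:
  fixes F w :: "'a::idom poly"
  assumes "w * reflect_poly w = F * reflect_poly F" "coeff F 0 \<noteq> 0"
  shows "coeff w 0 \<noteq> 0" "degree w = degree F"
proof -
  have "coeff (w * reflect_poly w) 0 \<noteq> 0"
    using assms by (auto simp: coeff_mult_0)
  then show w0: "coeff w 0 \<noteq> 0" by (auto simp: coeff_mult_0)
  have "w \<noteq> 0" "F \<noteq> 0" using w0 assms(2) by auto
  then have "degree w + degree (reflect_poly w) = degree F + degree (reflect_poly F)"
    using assms(1) degree_mult_eq[of w "reflect_poly w"] degree_mult_eq[of F "reflect_poly F"] by simp
  then show "degree w = degree F" using w0 assms(2) by simp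
qed

text \<open>If \<open>e + T\<close> has residue \<open>s\<close> modulo \<open>k\<close>, then
  \<open>i\<close> is congruent to \<open>2 * T - s\<close>: the window from 0 to
  \<open>2 * T\<close> is symmetric under reflection.\<close>

lemma mod_reflected_exponent:
  fixes T k L e i :: nat
  assumes "(e + T) mod k \<le> 2 * T" "2 * T < k" "i + e = k * L + T"
  shows "i mod k \<le> 2 * T"
proof -
  define q s where "q = (e + T) div k" and "s = (e + T) mod k"
  have "e + T = k * q + s" by (simp add: q_def s_def)
  then have "i + k * q = (2 * T - s) + k * L"
    using assms s_def by linarith
  then have "i mod k = (2 * T - s) mod k"
    by (metis mod_mult_self2)
  then show ?thesis using assms(2) by simp
qed

text \<open>Shifting by \<open>T\<close> puts all exponents into residues at most
  \<open>2 * T\<close>. Products of two lifts then have x-degree at most \<open>4 * T < k\<close>,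
  so no carry into y occurs and the identity itself lifts. The irreducible \<open>G\<close> is prime
  and must divide one of the two lifts of \<open>w\<close>.\<close>

lemma companion_trivial:
  fixes F w :: "int poly" and G :: "int poly poly"
  assumes comp: "w * reflect_poly w = F * reflect_poly F" and F0: "coeff F 0 \<noteq> 0"
    and F: "F = poly G (monom 1 k)" and G: "irreducible G"
    and T: "4 * T < k" "\<And>j. degree (coeff G j) \<le> T"
    and F_exps: "\<And>e. coeff F e \<noteq> 0 \<Longrightarrow> (e + T) mod k \<le> 2 * T"
    and w_exps: "\<And>e. coeff w e \<noteq> 0 \<Longrightarrow> (e + T) mod k \<le> 2 * T"
  shows "w = F \<or> w = - F \<or> w = reflect_poly F \<or> w = - reflect_poly F"
proof -
  note w0 = degree_companion[OF comp F0]
  \<comment> \<open>The shift \<open>c\<close> sends a reversed exponent \<open>D - e\<close> to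
    \<open>T + k * D - e\<close>, as \<open>mod_reflected_exponent\<close> requires. The subtraction
    does not truncate, since \<open>D\<close> is at most \<open>k * D\<close>.\<close>
  define D c where "D = degree F" and "c = T + k * D - D"
  have k: "k > 0" using T(1) by simp
  then have "1 * D \<le> k * D" by (intro mult_le_mono1) simp
  then have c: "c + D = T + k * D" unfolding c_def by linarith
  have cT: "degree (coeff (lift_poly k (monom 1 T * p)) j) \<le> 2 * T"
    if "\<And>e. coeff p e \<noteq> 0 \<Longrightarrow> (e + T) mod k \<le> 2 * T" for p j
  proof (rule degree_coeff_lift_poly_le)
    fix i assume "coeff (monom 1 T * p) i \<noteq> 0"
    then have "T \<le> i" "coeff p (i - T) \<noteq> 0"
      by (auto simp: coeff_monom_mult split: if_splits)
    then show "i mod k \<le> 2 * T"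
      using that[of "i - T"] by simp
  qed
  have cc: "degree (coeff (lift_poly k (monom 1 c * reflect_poly p)) j) \<le> 2 * T"
    if "\<And>e. coeff p e \<noteq> 0 \<Longrightarrow> (e + T) mod k \<le> 2 * T" "degree p = D" for p j
  proof (rule degree_coeff_lift_poly_le)
    fix i assume "coeff (monom 1 c * reflect_poly p) i \<noteq> 0"
    then have i: "c \<le> i" "i - c \<le> D" "coeff p (D - (i - c)) \<noteq> 0"
      using that(2) by (auto simp: coeff_monom_mult coeff_reflect_poly split: if_splits)
    show "i mod k \<le> 2 * T"
      by (rule mod_reflected_exponent[OF that(1)[OF i(3)], where L = D]) (use T(1) i(1,2) c in linarith)+
  qed
  define W W' H where "W = lift_poly k (monom 1 T * w)"
    and "W' = lift_poly k (monom 1 c * reflect_poly w)"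
    and "H = lift_poly k (monom 1 c * reflect_poly F)"
  have evals: "poly W (monom 1 k) = monom 1 T * w" "poly W' (monom 1 k) = monom 1 c * reflect_poly w"
    "poly H (monom 1 k) = monom 1 c * reflect_poly F"
    by (simp_all add: W_def W'_def H_def poly_lift_poly)
  have "W * W' = smult (monom 1 T) G * H"
  proof (rule poly_monom_inject[where k = k])
    fix j
    have "degree (coeff (W * W') j) \<le> 2 * T + 2 * T"
      using w0(2) unfolding W_def W'_def by (intro degree_coeff_mult_le cT cc w_exps) (simp_all add: D_def)
    then show "degree (coeff (W * W') j) < k" using T(1) by simp
    have "degree (coeff (smult (monom 1 T) G) i) \<le> 2 * T" for i
      using T(2)[of i] degree_mult_le[of "monom 1 T" "coeff G i"] degree_monom_le[of "1::int" T]
      by (simp add: mult_2)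
    then have "degree (coeff (smult (monom 1 T) G * H) j) \<le> 2 * T + 2 * T"
      unfolding H_def by (intro degree_coeff_mult_le cc F_exps) (simp_all add: D_def)
    then show "degree (coeff (smult (monom 1 T) G * H) j) < k" using T(1) by simp
  next
    show "poly (W * W') (monom 1 k) = poly (smult (monom 1 T) G * H) (monom 1 k)"
    proof -
      have "monom 1 T * w * (monom 1 c * reflect_poly w) = monom 1 T * monom 1 c * (w * reflect_poly w)"
        by (simp only: mult_ac)
      also have "\<dots> = monom 1 T * F * (monom 1 c * reflect_poly F)"
        unfolding comp by (simp only: mult_ac)
      finally show ?thesis by (simp add: evals flip: F)
    qed
  qed
  then have "G dvd W * W'" by (simp add: dvd_smult)
  then have GW: "G dvd W \<or> G dvd W'"
    using G prime_elem_dvd_mult_iff prime_elem_iff_irreducible by blast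
  \<comment> \<open>Returning to y = x^k, \<open>F\<close> divides x^u times \<open>p\<close>. Since
    \<open>F\<close> has nonzero constant term, x^u goes entirely into the cofactor, so
    \<open>F\<close> divides \<open>p\<close>. Equal degrees leave a constant quotient, and the
    companion identity makes its square 1.\<close>
  have assoc: "p = F \<or> p = - F"
    if G_dvd: "G dvd V" and V: "poly V (monom 1 k) = monom 1 u * p" and p: "p * reflect_poly p = F * reflect_poly F"
    for V p u
  proof -
    note p0 = degree_companion[OF p F0]
    obtain B where "V = G * B" using G_dvd by blast
    then have v: "monom 1 u * p = F * poly B (monom 1 k)" (is "_ = F * ?v")
      using V F by simp
    have "?v \<noteq> 0" using v p0 by auto
    moreover have "order 0 F = 0" using F0 by (simp add: order_0I poly_0_coeff_0)
    moreover have "monom 1 u dvd F * ?v" using v by (metis dvd_triv_left)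
    moreover have "F * ?v \<noteq> 0" using F0 \<open>?v \<noteq> 0\<close> by auto
    ultimately have "monom 1 u dvd ?v"
      using order_mult[of F ?v 0] by (simp add: monom_1_dvd_iff)
    then obtain g where "?v = monom 1 u * g" by blast
    then have "monom 1 u * p = monom 1 u * (F * g)" using v by (simp add: mult_ac)
    then have g: "p = F * g" by simp
    have "g \<noteq> 0" "F \<noteq> 0" using p0 g F0 by auto
    then have "degree g = 0" using p0 g degree_mult_eq[of F g] by simp
    then obtain a where a: "g = [:a:]" by (metis degree_eq_zeroE)
    have "[:a * a:] * (F * reflect_poly F) = 1 * (F * reflect_poly F)"
      using p g a by (simp add: reflect_poly_smult)
    then have "[:a * a:] = 1"
      using \<open>F \<noteq> 0\<close> by (subst (asm) mult_right_cancel) auto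
    then have "a * a = 1" by (simp add: one_pCons)
    then have "a = 1 \<or> a = - 1" by (simp add: square_eq_1_iff)
    then show ?thesis using g a by auto
  qed
  from GW show ?thesis
  proof
    assume "G dvd W"
    from assoc[OF this evals(1) comp] show ?thesis by blast
  next
    assume "G dvd W'"
    from assoc[OF this evals(2)] have "reflect_poly w = F \<or> reflect_poly w = - F"
      using comp w0(1) by (simp add: mult.commute)
    moreover have "w = reflect_poly (reflect_poly w)" using w0(1) by simp
    ultimately show ?thesis by (auto simp: reflect_poly_minus)
  qed
qed

section \<open>Simultaneous approximation of exponents\<close>

text \<open>Dirichlet's theorem with precision 1/8 is applied to the ratios e/n; multiplying by
  \<open>8 * n\<close> turns the estimate into one between integers.\<close>

lemma simultaneous_near_multiples:
  fixes E :: "nat set" and n r M :: nat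
  assumes "finite E" "card E \<le> M" "n > 0" "\<And>e. e \<in> E \<Longrightarrow> e \<le> (r + 1) * n"
  obtains m where "0 < m" "m \<le> 8 ^ M"
    "\<And>e. e \<in> E \<Longrightarrow> \<exists>p \<le> (r + 1) * m + 1. \<bar>int (8 * m * e) - int (8 * n * p)\<bar> < int n"
proof -
  obtain h where h: "bij_betw h {..<card E} E"
    using ex_bij_betw_nat_finite[OF assms(1)] by (auto simp: atLeast0LessThan)
  obtain q p where q: "0 < q" "q \<le> int (8 ^ card E)"
    and p: "\<And>i. i < card E \<Longrightarrow> \<bar>of_int q * (real (h i) / real n) - of_int (p i)\<bar> < 1 / real 8"
    using Dirichlet_approx_simult[of 8 "card E" "\<lambda>i. real (h i) / real n"] by (metis zero_less_numeral)
  show thesis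
  proof (rule that[of "nat q"])
    have "int (8 ^ card E) \<le> int (8 ^ M)" using assms(2) by simp
    with q(2) have "q \<le> int (8 ^ M)" by (rule order_trans)
    then show "0 < nat q" "nat q \<le> 8 ^ M" using q by auto
    fix e assume e: "e \<in> E"
    obtain i where i: "i < card E" "e = h i"
      using h e by (auto simp: bij_betw_def)
    define a where "a = p i"
    have "\<bar>of_int q * (real e / real n) - of_int a\<bar> < 1 / 8"
      using p[OF i(1)] i(2) a_def by simp
    then have "\<bar>of_int q * (real e / real n) - of_int a\<bar> * (8 * real n) < 1 / 8 * (8 * real n)"
      using assms(3) by (intro mult_strict_right_mono) auto
    moreover have "\<bar>of_int q * (real e / real n) - of_int a\<bar> * (8 * real n)
        = \<bar>(of_int q * (real e / real n) - of_int a) * (8 * real n)\<bar>"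
      by (simp add: abs_mult)
    moreover have "(of_int q * (real e / real n) - of_int a) * (8 * real n)
        = of_int (8 * q * int e - 8 * int n * a)"
      using assms(3) by (simp add: field_simps)
    ultimately have "real_of_int \<bar>8 * q * int e - 8 * int n * a\<bar> < real_of_int (int n)" by simp
    then have near: "\<bar>8 * q * int e - 8 * int n * a\<bar> < int n" by (simp only: of_int_less_iff)
    \<comment> \<open>Here \<open>8 * n * a\<close> exceeds a non-negative number minus
      \<open>n\<close>, so \<open>8 * a > - 1\<close> and the integer \<open>a\<close> is
      non-negative. The bound on \<open>e\<close> gives the upper bound on \<open>a\<close> in the
      same way.\<close>
    have "0 \<le> q * int e" using q by simp
    then have "int n * (8 * a) > int n * (- 1)" using near by (simp add: algebra_simps)
    then have a0: "a \<ge> 0" using assms(3) by (subst (asm) mult_less_cancel_left_pos) auto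
    have "int e \<le> (int r + 1) * int n" using assms(4)[OF e] by (metis of_nat_1 of_nat_add of_nat_le_iff of_nat_mult)
    then have "q * int e \<le> q * ((int r + 1) * int n)" using q by simp
    then have "int n * (8 * a) < int n * (8 * (q * (int r + 1)) + 1)"
      using near by (simp add: algebra_simps)
    then have "8 * a < 8 * (q * (int r + 1)) + 1"
      using assms(3) by (subst (asm) mult_less_cancel_left_pos) auto
    then have "a \<le> (int r + 1) * q + 1" by (simp add: algebra_simps)
    then have "nat a \<le> (r + 1) * nat q + 1"
      using q a0 by (simp add: nat_le_iff algebra_simps)
    moreover have "\<bar>int (8 * nat q * e) - int (8 * n * nat a)\<bar> < int n"
      using near q a0 by simp
    ultimately show "\<exists>p \<le> (r + 1) * nat q + 1. \<bar>int (8 * nat q * e) - int (8 * n * p)\<bar> < int n" by blast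
  qed
qed

text \<open>Dividing by \<open>8 * m\<close> puts \<open>e\<close> within (k+1)/8 of n p/m, and n
  p/m = k p + t p/m differs from k p by at most \<open>p\<close>. Thus \<open>e - k * p\<close> lies
  between \<open>- T\<close> and \<open>T\<close>.\<close>

lemma near_multiple_mod:
  fixes n m k t e p T :: nat
  assumes n: "n = k * m + t" "t < m" and near: "\<bar>int (8 * m * e) - int (8 * n * p)\<bar> < int n"
    and T: "8 * p + k + 1 \<le> 8 * T" "2 * T < k"
  shows "(e + T) mod k \<le> 2 * T"
proof -
  define a where "a = int e - int k * int p"
  have nm: "int n = int k * int m + int t" using n by simp
  have "8 * int m * int e - 8 * int n * int p = int m * (8 * a) - 8 * (int t * int p)"
    by (simp add: nm a_def algebra_simps)
  then have near': "\<bar>int m * (8 * a) - 8 * (int t * int p)\<bar> < int n" using near by simp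
  have n_lt: "int n < int m * (int k + 1)" using n by (simp add: algebra_simps)
  have tp: "0 \<le> int t * int p" "int t * int p \<le> int m * int p"
    using n by (auto intro: mult_right_mono)
  have "int m * (8 * a) < int m * (8 * int p + int k + 1)"
    using near' n_lt tp by (simp add: algebra_simps)
  then have up: "8 * a < 8 * int p + int k + 1"
    using n by (subst (asm) mult_less_cancel_left_pos) auto
  have "int m * (- (int k + 1)) < int m * (8 * a)"
    using near' n_lt tp(1) mult_minus_right[of "int m" "int k + 1"] by linarith
  then have lo: "- (int k + 1) < 8 * a"
    using n by (subst (asm) mult_less_cancel_left_pos) auto
  have bounds: "- int T \<le> a" "a \<le> int T" using up lo T by linarith+
  have "int (e + T) = (a + int T) + int k * int p" by (simp add: a_def)
  then have "int ((e + T) mod k) = (a + int T) mod int k"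
    by (simp only: zmod_int mod_mult_self2)
  also have "\<dots> = a + int T" using bounds T(2) by (intro mod_pos_pos_trivial) linarith+
  also have "\<dots> \<le> int (2 * T)" using bounds by simp
  finally show ?thesis by simp
qed

section \<open>The polynomials F(x, x^n) and their two-variable forms\<close>

lemma poly_bivar: "poly (bivar r f) (monom 1 n) = (\<Sum>j\<le>r. monom 1 (j * n) * f j)"
  by (simp add: bivar_def poly_sum poly_monom monom_power mult_ac)

lemma poly_bivar_plus:
  "poly (bivar_plus r f t l) (monom 1 k) = poly (bivar r f) (monom 1 (k * l + t))"
proof -
  have "f j * monom 1 (j * t) * monom 1 k ^ (j * l) = monom 1 (j * (k * l + t)) * f j" for j
  proof -
    have "f j * monom 1 (j * t) * monom 1 k ^ (j * l) = f j * monom 1 (j * t + k * (j * l))"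
      by (simp only: mult.assoc monom_power mult_monom power_one mult_1)
    also have "j * t + k * (j * l) = j * (k * l + t)"
      by (simp add: algebra_simps)
    finally show ?thesis by (simp only: mult.commute)
  qed
  then show ?thesis
    unfolding bivar_plus_def poly_bivar poly_sum poly_monom by (simp only:)
qed

lemma coeff_bivar_plus_0_0: "l \<ge> 1 \<Longrightarrow> coeff (coeff (bivar_plus r f t l) 0) 0 = coeff (f 0) 0"
proof -
  assume l: "l \<ge> 1"
  have "coeff (bivar_plus r f t l) 0 = (\<Sum>j\<le>r. if j = 0 then f 0 else 0)"
    unfolding bivar_plus_def coeff_sum using l by (intro sum.cong) (auto simp: monom_0)
  then show ?thesis by simp
qed

lemma degree_coeff_bivar_plus_le:
  assumes "\<And>j. j \<le> r \<Longrightarrow> degree (f j) \<le> d"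
  shows "degree (coeff (bivar_plus r f t l) i) \<le> d + r * t"
proof -
  have "degree (coeff (monom (f j * monom 1 (j * t)) (j * l)) i) \<le> d + r * t" if "j \<le> r" for j
  proof -
    have "degree (f j * monom 1 (j * t)) \<le> degree (f j) + j * t"
      using degree_mult_le[of "f j" "monom 1 (j * t)"] degree_monom_le[of "1::int" "j * t"] by linarith
    also have "\<dots> \<le> d + r * t" using assms that by (intro add_mono mult_right_mono) auto
    finally show ?thesis by auto
  qed
  then show ?thesis unfolding bivar_plus_def coeff_sum by (intro degree_sum_le) auto
qed

text \<open>For \<open>l \<ge> 1\<close> only \<open>j = 0\<close> contributes to y^0, so the
  constant term is that of \<open>f 0\<close>. As it is nonzero, the power of x is trivial.\<close>

lemma irreducible_bivar_plus:
  assumes "x_power_times_irreducible (bivar_plus r f t l)" "l \<ge> 1" "coeff (f 0) 0 \<noteq> 0"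
  shows "irreducible (bivar_plus r f t l)"
proof -
  obtain a P where P: "irreducible P" "bivar_plus r f t l = [:monom 1 a:] * P"
    using assms(1) by (auto simp: x_power_times_irreducible_def)
  have "coeff (monom 1 a * coeff P 0) 0 \<noteq> 0"
    using coeff_bivar_plus_0_0[OF assms(2), of r f t] assms(3) P(2) by simp
  then have "a = 0" by (auto simp: coeff_monom_mult split: if_splits)
  then show ?thesis using P by (simp flip: one_pCons)
qed

lemma sum_abs_coeff_bivar_le:
  "(\<Sum>i\<le>D. \<bar>coeff (poly (bivar r f) (monom 1 n)) i\<bar>) \<le> (\<Sum>j\<le>r. \<Sum>i\<le>degree (f j). \<bar>coeff (f j) i\<bar>)"
proof -
  have "(\<Sum>i\<le>D. \<bar>coeff (poly (bivar r f) (monom 1 n)) i\<bar>)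
      \<le> (\<Sum>i\<le>D. \<Sum>j\<le>r. \<bar>coeff (monom 1 (j * n) * f j) i\<bar>)"
    unfolding poly_bivar coeff_sum by (intro sum_mono sum_abs)
  also have "\<dots> = (\<Sum>j\<le>r. \<Sum>i\<le>D. \<bar>coeff (monom 1 (j * n) * f j) i\<bar>)"
    by (rule sum.swap)
  also have "\<dots> \<le> (\<Sum>j\<le>r. \<Sum>i\<le>degree (f j). \<bar>coeff (f j) i\<bar>)"
    by (intro sum_mono sum_coeff_shift_le)
  finally show ?thesis .
qed

lemma coeff_poly_bivar_nonzeroE:
  assumes "coeff (poly (bivar r f) (monom 1 n)) e \<noteq> 0" "\<And>j. j \<le> r \<Longrightarrow> degree (f j) \<le> d"
  obtains j u where "j \<le> r" "u \<le> d" "e = j * n + u"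
proof -
  obtain j where j: "j \<le> r" "coeff (monom 1 (j * n) * f j) e \<noteq> 0"
    using assms(1) unfolding poly_bivar coeff_sum by (meson atMost_iff sum.not_neutral_contains_not_neutral)
  then have "e \<ge> j * n" "coeff (f j) (e - j * n) \<noteq> 0"
    by (auto simp: coeff_monom_mult split: if_splits)
  moreover from this(2) have "e - j * n \<le> d"
    using assms(2)[OF j(1)] le_degree order_trans by blast
  ultimately show thesis
    using that[of j "e - j * n"] j(1) by simp
qed

section \<open>Choice of constants and conclusion\<close>

theorem theorem1:
  fixes r :: nat and f :: "nat \<Rightarrow> int poly"
  assumes "r \<ge> 1"
    and "\<forall>d. (\<forall>j\<le>r. d dvd f j) \<longrightarrow> d = 1 \<or> d = -1"
    and "poly (f 0) 0 \<noteq> 0"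
    and "f r \<noteq> 0"
  shows "\<exists>N. \<forall>n\<ge>N. n > 0 \<longrightarrow> plus_condition r f n \<longrightarrow> minus_condition r f n \<longrightarrow>
           (let P = nonreciprocal_part (poly (bivar r f) (monom 1 n))
            in P = 1 \<or> P = -1 \<or> irreducible P)"
proof -
  define d where "d = Max ((\<lambda>j. degree (f j)) ` {0..r})"
  have d: "degree (f j) \<le> d" if "j \<le> r" for j
    unfolding d_def using that by (intro Max_ge) auto
  \<comment> \<open>\<open>M\<close> will bound the number of terms of \<open>w\<close>,
    \<open>Q\<close> the approximating multiplier \<open>m\<close>, and \<open>K\<close> is a lower
    bound for \<open>k\<close> large enough for all inequalities among \<open>d\<close>,
    \<open>t\<close>, \<open>p\<close>, \<open>k\<close> and \<open>T\<close> below. None of them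
    depends on \<open>n\<close>.\<close>
  define M where "M = nat ((\<Sum>j\<le>r. \<Sum>i\<le>degree (f j). \<bar>coeff (f j) i\<bar>)\<^sup>2)"
  define Q where "Q = (8::nat) ^ M"
  define K where "K = 100 + 8 * d + 10 * (r + 1) * (r + 1) * Q"
  have f0: "coeff (f 0) 0 \<noteq> 0" using assms(3) by (simp add: poly_0_coeff_0)
  have "P = 1 \<or> P = - 1 \<or> irreducible P"
    \<comment> \<open>The term \<open>Q * K\<close> ensures \<open>n div m \<ge> K\<close> for every
      positive \<open>m \<le> Q\<close>; the rest gives \<open>n > 0\<close> and
      \<open>d \<le> n\<close>, the latter for the bound on the degree of \<open>F\<close>.\<close>
    if n: "n \<ge> Q * K + d + 1" and plus: "plus_condition r f n"
      and P: "P = nonreciprocal_part (poly (bivar r f) (monom 1 n))" for n P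
  proof (rule ccontr)
    define F where "F = poly (bivar r f) (monom 1 n)"
    have n0: "n > 0" "d \<le> n" using n by auto
    have "coeff F 0 = (\<Sum>j\<le>r. if j = 0 then coeff (f 0) 0 else 0)"
      unfolding F_def poly_bivar coeff_sum using n0(1) by (intro sum.cong) (auto simp: coeff_monom_mult)
    then have F0: "coeff F 0 \<noteq> 0" using f0 by simp
    assume "\<not> (P = 1 \<or> P = - 1 \<or> irreducible P)"
    then obtain w where comp: "w * reflect_poly w = F * reflect_poly F"
      and w: "w \<noteq> F" "w \<noteq> - F" "w \<noteq> reflect_poly F" "w \<noteq> - reflect_poly F"
      using nonreciprocal_part_reducible_companion[OF F0] P F_def by blast
    note w0 = degree_companion[OF comp F0]
    define E where "E = {e. coeff w e \<noteq> 0}"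
    have E_sub: "E \<subseteq> {..degree w}" by (auto simp: E_def intro: le_degree)
    have "(\<Sum>i\<le>degree F. \<bar>coeff F i\<bar>)\<^sup>2 \<le> (\<Sum>j\<le>r. \<Sum>i\<le>degree (f j). \<bar>coeff (f j) i\<bar>)\<^sup>2"
      unfolding F_def by (intro power_mono sum_abs_coeff_bivar_le sum_nonneg) auto
    then have card_E: "card E \<le> M"
      using card_support_companion_le[OF comp w0(2)] by (simp add: E_def M_def le_nat_iff)
    have "degree F \<le> (r + 1) * n"
    proof -
      have "coeff F (degree F) \<noteq> 0" using F0 by auto
      then obtain j u where "j \<le> r" "u \<le> d" "degree F = j * n + u"
        unfolding F_def using d by (rule coeff_poly_bivar_nonzeroE)
      moreover from this have "j * n \<le> r * n" by (intro mult_le_mono1)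
      ultimately show ?thesis using n0(2) unfolding add_mult_distrib by linarith
    qed
    then have E_le: "e \<le> (r + 1) * n" if "e \<in> E" for e using that E_sub w0(2) by auto
    obtain m where m: "0 < m" "m \<le> Q"
      and near: "\<And>e. e \<in> E \<Longrightarrow> \<exists>p \<le> (r + 1) * m + 1. \<bar>int (8 * m * e) - int (8 * n * p)\<bar> < int n"
      unfolding Q_def using simultaneous_near_multiples[OF finite_subset[OF E_sub] card_E n0(1) E_le] by blast
    \<comment> \<open>\<open>T\<close> is the largest natural number with \<open>4 * T < k\<close>.
      Being about k/4, it still exceeds the approximation error of about k/8 by a margin that
      absorbs \<open>p\<close>.\<close>
    define k t T where "k = n div m" and "t = n mod m" and "T = (k - 1) div 4"
    have nk: "n = k * m + t" "t < m" using m by (simp_all add: k_def t_def)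
    have "K * m \<le> n" using n mult_le_mono2[OF m(2), of K] mult.commute[of K Q] by linarith
    then have kK: "K \<le> k" using m(1) by (simp add: k_def less_eq_div_iff_mult_less_eq)
    have Tk: "4 * T < k" "k \<le> 4 * T + 4" using kK unfolding K_def T_def by linarith+
    have tQ: "t \<le> Q" using nk m by simp
    have Q_le: "Q \<le> (r + 1) * (r + 1) * Q" "r * Q \<le> (r + 1) * (r + 1) * Q"
       "(r + 1) * Q \<le> (r + 1) * (r + 1) * Q" "r * (r + 1) * Q \<le> (r + 1) * (r + 1) * Q"
      by (simp_all add: algebra_simps)
    have rt: "r * t \<le> r * Q" "r * (r + 1) * t \<le> r * (r + 1) * Q" "(r + 1) * m \<le> (r + 1) * Q"
      by (rule mult_le_mono2[OF tQ] mult_le_mono2[OF m(2)])+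
    define G where "G = bivar_plus r f t m"
    have "d + r * t \<le> T" using rt Q_le kK Tk unfolding K_def by linarith
    have "k \<ge> 2 * d" using kK unfolding K_def by linarith
    moreover have "real t < real k / real (r * (r + 1))"
    proof -
      have "r * (r + 1) * t < k" using rt Q_le kK unfolding K_def by linarith
      then have "real (r * (r + 1)) * real t < real k" by (metis of_nat_less_iff of_nat_mult)
      moreover have "real (r * (r + 1)) > 0" using assms(1) by (simp only: of_nat_0_less_iff) simp
      ultimately show ?thesis by (simp only: pos_less_divide_eq mult.commute)
    qed
    ultimately have "x_power_times_irreducible G"
      using plus nk(1) m(1) unfolding plus_condition_def G_def d_def[symmetric] by simp
    then have "irreducible G"
      using irreducible_bivar_plus m(1) f0 unfolding G_def by simp
    moreover have "F = poly G (monom 1 k)"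
      by (simp add: F_def G_def poly_bivar_plus flip: nk(1))
    moreover have "degree (coeff G i) \<le> T" for i
      using degree_coeff_bivar_plus_le[of r f d t m i] d \<open>d + r * t \<le> T\<close> unfolding G_def by fastforce
    moreover have "(e + T) mod k \<le> 2 * T" if "coeff F e \<noteq> 0" for e
    proof -
      obtain j u where ju: "j \<le> r" "u \<le> d" "e = j * n + u"
        using \<open>coeff F e \<noteq> 0\<close> d unfolding F_def by (rule coeff_poly_bivar_nonzeroE)
      have "j * t + u \<le> T"
        using ju \<open>d + r * t \<le> T\<close> mult_le_mono1[of j r t] by linarith
      \<comment> \<open>From n = k m + t, the exponent j n + u is k (j m) plus the small remainder j
        t + u.\<close>
      moreover have "e + T = (j * t + u + T) + k * (j * m)"
        using ju(3) nk(1) by (simp add: algebra_simps)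
      then have "(e + T) mod k = (j * t + u + T) mod k" by (simp only: mod_mult_self2)
      ultimately show ?thesis using Tk(1) by simp
    qed
    moreover have "(e + T) mod k \<le> 2 * T" if "coeff w e \<noteq> 0" for e
    proof -
      obtain p where p: "p \<le> (r + 1) * m + 1" "\<bar>int (8 * m * e) - int (8 * n * p)\<bar> < int n"
        using near \<open>coeff w e \<noteq> 0\<close> by (auto simp: E_def)
      have "8 * p + k + 1 \<le> 8 * T" "2 * T < k"
        using p(1) rt Q_le kK Tk unfolding K_def by linarith+
      then show ?thesis by (rule near_multiple_mod[OF nk p(2)])
    qed
    ultimately show False
      using companion_trivial[OF comp F0, of G k T] Tk(1) w by blast
  qed
  then show ?thesis
    unfolding Let_def by blast
qed

end
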